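(* Let $0\le\theta<\pi$, $\theta\neq\frac{\pi}{3}$, and put $C=\cos\frac{\theta}{2}$, $S=\sin\frac{\theta}{2}$. Suppose that a $\theta$-equiangular unit equilateral hexagon $\mathcal P=(P_0,\dots,P_5)$ in $\mathbb R^3$ is parametrized by angles $\varphi_1,\varphi_3,\varphi_5\in(-\pi,\pi]$ via $$P_0=(-S,0,0),\quad P_2=(S,0,0),\quad P_4=(0,\sqrt3\,S,0),$$ $$P_1=\big(0,\,-C\cos\varphi_1,\,C\sin\varphi_1\big),$$ $$P_3=\Big(\tfrac12S+\tfrac{\sqrt3}{2}C\cos\varphi_3,\ \tfrac{\sqrt3}{2}S+\tfrac12C\cos\varphi_3,\ C\sin\varphi_3\Big),$$ $$P_5=\Big(-\tfrac12S-\tfrac{\sqrt3}{2}C\cos\varphi_5,\ \tfrac{\sqrt3}{2}S+\tfrac12C\cos\varphi_5,\ C\sin\varphi_5\Big).$$ Put $$a=C\big(C\cos\varphi_1+\sqrt3\,S\big),\quad b=-2C^2\sin\varphi_1,\quad d=3-5C^2-\sqrt3\,SC\cos\varphi_1,$$ and let $(\ast)$ denote the equality of two-element sets $$\{(\cos\varphi_3,\sin\varphi_3),(\cos\varphi_5,\sin\varphi_5)\}=\left\{\left(\frac{ad+\epsilon b\sqrt{a^2+b^2-d^2}}{a^2+b^2},\ \frac{bd-\epsilon a\sqrt{a^2+b^2-d^2}}{a^2+b^2}\right)\ :\ \epsilon\in\{1,-1\}\right\}.$$ (In each formula with $\pm$ or $\mp$ below, either all upper signs or all lower signs are taken.) 1.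 When $\theta=\frac{2\pi}{3}$, i.e. $C=\frac12$, we have $\varphi_1=\varphi_3=\varphi_5=0$, which corresponds to a regular hexagon. 2. When $\frac{\pi}{3}<\theta<\frac{2\pi}{3}$, i.e. $\frac12<C<\frac{\sqrt3}{2}$, we have $-\arccos\left(\frac{(3-8C^2)S}{\sqrt3\,C}\right)\le\varphi_1\le\arccos\left(\frac{(3-8C^2)S}{\sqrt3\,C}\right)$. (i) When $\varphi_1=\pm\arccos\left(\frac{(3-8C^2)S}{\sqrt3\,C}\right)$ we have $\varphi_3=\varphi_5=\mp\arccos\left(\frac{S}{\sqrt3\,C}\right)$, which corresponds to a boat. (ii) When $-\arccos\left(\frac{(3-8C^2)S}{\sqrt3\,C}\right)<\varphi_1<\arccos\left(\frac{(3-8C^2)S}{\sqrt3\,C}\right)$ we have either - $\varphi_3\ne\varphi_5$, and these are given by $(\ast)$; or - $\varphi_1=\varphi_3=\varphi_5=\pm\arccos\left(\frac{S}{\sqrt3\,C}\right)$, which corresponds to a chair. 3. When $0<\theta<\frac{\pi}{3}$, i.e. $\frac{\sqrt3}{2}<C<1$, we have $\arccos\left(\frac{\sqrt3\,S}{C}\right)\le|\varphi_1|\le\arccos\left(\frac{(3-8C^2)S}{\sqrt3\,C}\right)$. (i) When $\varphi_1=\pm\arccos\left(\frac{(3-8C^2)S}{\sqrt3\,C}\right)$ we have $\varphi_3=\varphi_5=\pm\arccos\left(\frac{S}{\sqrt3\,C}\right)$, which corresponds to a boat. (ii) When $\varphi_1=\pm\arccos\left(\frac{\sqrt3\,S}{C}\right)$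 we have $\varphi_3=\varphi_5=\pm\arccos\left(-\frac{\sqrt3\,S}{C}\right)=\pm\left(\pi-\arccos\left(\frac{\sqrt3\,S}{C}\right)\right)$. (iii) When $\arccos\left(\frac{\sqrt3\,S}{C}\right)<|\varphi_1|<\arccos\left(\frac{(3-8C^2)S}{\sqrt3\,C}\right)$ we have either - $\varphi_3\ne\varphi_5$, and these are given by $(\ast)$; or - $\varphi_1=\varphi_3=\varphi_5=\pm\arccos\left(\frac{S}{\sqrt3\,C}\right)$, which corresponds to a chair; or - $\varphi_1=\varphi_3=\varphi_5=\pm\arccos\left(-\frac{\sqrt3\,S}{C}\right)$, which corresponds to an inward crown. 4. When $\theta=0$ the hexagon degenerates to a $6$ times covered multiple edge (that is, $P_0=P_2=P_4$ and $P_1=P_3=P_5$).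
   Context: Indices of vertices are modulo $6$. A $\theta$-equiangular unit equilateral hexagon is a $6$-tuple $\mathcal P=(P_0,\dots,P_5)$ of points of $\mathbb R^3$ with $|P_i-P_{i+1}|=1$ and $\angle P_{i-1}P_iP_{i+1}=\theta$ for all $i$ modulo $6$. Intersections of edges and coincidences of vertices are allowed. (In such a hexagon $P_0,P_2,P_4$ form a regular triangle of side $2S$, so up to orientation preserving isometry of $\mathbb R^3$ it can be written in the parametrized form used in the claim.) Boat and chair: a $\theta$-equiangular unit equilateral hexagon is called a boat (resp. a chair) if for some $i$ one has $\overrightarrow{P_{i-1}P_{i-2}}=\overrightarrow{P_{i+1}P_{i+2}}$, the four points $P_{i-1},P_{i+1},P_{i+2},P_{i-2}$ being the vertices of a non-degenerate parallelogram, and the points $P_i$ and $P_{i+3}$ lie strictly on the same side (resp. strictly on opposite sides) of the plane containing these four points. Inward crown (for $0<\theta<\frac\pi3$): the hexagon with $P_0=(-S,0,0)$, $P_2=(S,0,0)$, $P_4=(0,\sqrt3S,0)$ and $P_1=(0,\sqrt3\,S,h)$, $P_3=(-S,0,h)$, $P_5=(S,0,h)$, where $h=\sqrt{4C^2-3}$, or its mirror image ($h=-\sqrt{4C^2-3}$). *)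

theory Defs
  imports "HOL-Analysis.Analysis"
begin

text \<open>A hexagon is a function on the type \<open>6\<close> of "HOL-Library.Numeral_Type", whose ring
  operations are those of the integers modulo 6.\<close>

type_synonym hexagon = "6 \<Rightarrow> real^3"

definition vertex_angle :: "real^3 \<Rightarrow> real^3 \<Rightarrow> real^3 \<Rightarrow> real" where
  "vertex_angle A B D = arccos (((A - B) \<bullet> (D - B)) / (norm (A - B) * norm (D - B)))"

definition equiangular_unit_hexagon :: "real \<Rightarrow> hexagon \<Rightarrow> bool" where
  "equiangular_unit_hexagon \<theta> P \<longleftrightarrow>
     (\<forall>i. dist (P i) (P (i + 1)) = 1 \<and> vertex_angle (P (i - 1)) (P i) (P (i + 1)) = \<theta>)"

text \<open>A labelled regular hexagon in space; the two orientations of the labelling are covered by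
  the free choice of the orthonormal pair \<open>u, v\<close>.\<close>

definition regular_hexagon :: "hexagon \<Rightarrow> bool" where
  "regular_hexagon P \<longleftrightarrow>
     (\<exists>c u v r. norm u = 1 \<and> norm v = 1 \<and> u \<bullet> v = 0 \<and> r > 0 \<and>
        (\<forall>k::nat. k < 6 \<longrightarrow> P (of_nat k) =
           c + r *\<^sub>R (cos (2 * pi * real k / 6) *\<^sub>R u + sin (2 * pi * real k / 6) *\<^sub>R v)))"

text \<open>The plane \<open>{x. n \<bullet> x = c}\<close> with \<open>n \<noteq> 0\<close> contains \<open>X\<close>, and \<open>A, B\<close> lie strictly on the same side
  (strictly on opposite sides) of it. The plane is unique when \<open>X\<close> is coplanar but not collinear.\<close>

definition strictly_same_side :: "(real^3) set \<Rightarrow> real^3 \<Rightarrow> real^3 \<Rightarrow> bool" where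
  "strictly_same_side X A B \<longleftrightarrow>
     (\<exists>n c. n \<noteq> 0 \<and> (\<forall>x\<in>X. n \<bullet> x = c) \<and>
        ((n \<bullet> A > c \<and> n \<bullet> B > c) \<or> (n \<bullet> A < c \<and> n \<bullet> B < c)))"

definition strictly_opposite_sides :: "(real^3) set \<Rightarrow> real^3 \<Rightarrow> real^3 \<Rightarrow> bool" where
  "strictly_opposite_sides X A B \<longleftrightarrow>
     (\<exists>n c. n \<noteq> 0 \<and> (\<forall>x\<in>X. n \<bullet> x = c) \<and>
        ((n \<bullet> A > c \<and> n \<bullet> B < c) \<or> (n \<bullet> A < c \<and> n \<bullet> B > c)))"

text \<open>The equality of vectors makes \<open>P (i - 1), P (i + 1), P (i + 2), P (i - 2)\<close> (in this cyclic
  order) a possibly degenerate parallelogram; it is non-degenerate iff the four points are not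
  collinear.\<close>

definition parallelogram_at :: "hexagon \<Rightarrow> 6 \<Rightarrow> bool" where
  "parallelogram_at P i \<longleftrightarrow>
     P (i - 2) - P (i - 1) = P (i + 2) - P (i + 1) \<and>
     \<not> collinear {P (i - 1), P (i + 1), P (i + 2), P (i - 2)}"

definition boat :: "real \<Rightarrow> hexagon \<Rightarrow> bool" where
  "boat \<theta> P \<longleftrightarrow> equiangular_unit_hexagon \<theta> P \<and>
     (\<exists>i. parallelogram_at P i \<and>
        strictly_same_side {P (i - 1), P (i + 1), P (i + 2), P (i - 2)} (P i) (P (i + 3)))"

definition chair :: "real \<Rightarrow> hexagon \<Rightarrow> bool" where
  "chair \<theta> P \<longleftrightarrow> equiangular_unit_hexagon \<theta> P \<and>
     (\<exists>i. parallelogram_at P i \<and>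
        strictly_opposite_sides {P (i - 1), P (i + 1), P (i + 2), P (i - 2)} (P i) (P (i + 3)))"

definition inward_crown :: "real \<Rightarrow> hexagon \<Rightarrow> bool" where
  "inward_crown \<theta> P \<longleftrightarrow> 0 < \<theta> \<and> \<theta> < pi / 3 \<and>
     (let C = cos (\<theta> / 2); S = sin (\<theta> / 2) in
      \<exists>h \<in> {sqrt (4 * C\<^sup>2 - 3), - sqrt (4 * C\<^sup>2 - 3)}.
        P 0 = vector [- S, 0, 0] \<and> P 2 = vector [S, 0, 0] \<and> P 4 = vector [0, sqrt 3 * S, 0] \<and>
        P 1 = vector [0, sqrt 3 * S, h] \<and> P 3 = vector [- S, 0, h] \<and> P 5 = vector [S, 0, h])"

text \<open>The right-hand side lists the two points of the unit circle on the line
  \<open>a * x + b * y = d\<close>. No side conditions are needed for the totalized operations: the left-hand side consists of points of the unit circle, and with \<open>x / 0 = 0\<close> and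
  \<open>sqrt (- x) = - sqrt x\<close> the points on the right-hand side are off the unit circle
  if \<open>a\<^sup>2 + b\<^sup>2 = 0\<close> or \<open>a\<^sup>2 + b\<^sup>2 - d\<^sup>2 < 0\<close>.\<close>

definition star_condition :: "real \<Rightarrow> real \<Rightarrow> real \<Rightarrow> real \<Rightarrow> real \<Rightarrow> bool" where
  "star_condition a b d \<phi>3 \<phi>5 \<longleftrightarrow>
     {(cos \<phi>3, sin \<phi>3), (cos \<phi>5, sin \<phi>5)} =
     {((a * d + \<epsilon> * b * sqrt (a\<^sup>2 + b\<^sup>2 - d\<^sup>2)) / (a\<^sup>2 + b\<^sup>2),
       (b * d - \<epsilon> * a * sqrt (a\<^sup>2 + b\<^sup>2 - d\<^sup>2)) / (a\<^sup>2 + b\<^sup>2)) | \<epsilon>. \<epsilon> \<in> {1, -1}}"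

end

theory Submission
  imports Defs
begin

text \<open>Put \<open>t = \<surd>3 tan (\<theta>/2)\<close>. The parametrization makes the angles at \<open>P\<^sub>1, P\<^sub>3, P\<^sub>5\<close>
  equal to \<open>\<theta>\<close>, and the angles at \<open>P\<^sub>0, P\<^sub>2, P\<^sub>4\<close> are \<open>\<theta>\<close> iff any two \<open>x, y\<close> of the three
  angles \<open>\<phi>\<^sub>i\<close> satisfy
  \<open>t (cos x + cos y) + cos x cos y - 2 sin x sin y = t\<^sup>2 - 2\<close>.
  For fixed \<open>x = \<phi>\<^sub>1\<close> this is the equation of a line which contains the points of the unit circle at
  the angles \<open>\<phi>\<^sub>3\<close> and \<open>\<phi>\<^sub>5\<close>. Its discriminant factors as
  \<open>(t - cos x) ((t\<^sup>2 + 3) cos x - t (t\<^sup>2 - 5))\<close>: nonnegativity gives the bounds on \<open>\<phi>\<^sub>1\<close>, tangency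
  gives the two extreme cases, and if \<open>\<phi>\<^sub>3 \<noteq> \<phi>\<^sub>5\<close> the two points are the two intersections
  listed in \<open>(\<ast>)\<close>. If \<open>\<phi>\<^sub>3 = \<phi>\<^sub>5 = y\<close>, the relation between \<open>y\<close> and itself is
  \<open>(cos y + t) (3 cos y - t) = 0\<close>, which leaves the boat, the chair and the crown.\<close>

section \<open>Indices modulo 6, and recovering an angle from its cosine and sine\<close>

text \<open>Evaluating \<open>i - 1\<close> or \<open>i - 2\<close> at a literal index can leave
  \<open>-1\<close>, which has to become the name of a vertex.\<close>

lemma neg_one_6: "(-1::6) = 5"
proof -
  have "(6::6) = 0" by simp
  then have "(5::6) + 1 = 0" by simp
  then show ?thesis by (simp add: add_eq_0_iff)
qed

lemma hexagon_inner:
  assumes "equiangular_unit_hexagon \<theta> P"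
  shows "(P (i - 1) - P i) \<bullet> (P (i + 1) - P i) = cos \<theta>"
proof -
  have "dist (P (i - 1)) (P (i - 1 + 1)) = 1" "dist (P i) (P (i + 1)) = 1"
    and ang: "vertex_angle (P (i - 1)) (P i) (P (i + 1)) = \<theta>"
    using assms unfolding equiangular_unit_hexagon_def by blast+
  then have n: "norm (P (i - 1) - P i) = 1" "norm (P (i + 1) - P i) = 1"
    by (simp_all add: dist_norm norm_minus_commute)
  \<comment> \<open>Cauchy-Schwarz puts the quotient into [-1, 1], where \<open>cos\<close> undoes
    the \<open>arccos\<close> of \<open>vertex_angle\<close>.\<close>
  then have "\<bar>(P (i - 1) - P i) \<bullet> (P (i + 1) - P i)\<bar> \<le> 1"
    using Cauchy_Schwarz_ineq2[of "P (i - 1) - P i" "P (i + 1) - P i"] by simp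
  then show ?thesis using ang n unfolding vertex_angle_def by (auto simp: cos_arccos_abs)
qed

lemma cos_sin_eqD:
  fixes x y :: real
  assumes "x \<in> {-pi<..pi}" "y \<in> {-pi<..pi}" "cos x = cos y" "sin x = sin y"
  shows "x = y"
proof -
  obtain n :: int where n: "x = y + 2 * pi * of_int n"
    using assms(3,4) sin_cos_eq_iff by metis
  have "\<bar>x - y\<bar> < 2 * pi" using assms(1,2) by auto
  then have "2 * pi * \<bar>of_int n :: real\<bar> < 2 * pi * 1" by (simp add: n abs_mult)
  then have "\<bar>of_int n :: real\<bar> < 1" by (subst (asm) mult_less_cancel_left_pos) auto
  then have "n = 0" by linarith
  then show ?thesis using n by simp
qed

lemma arccos_cos_abs:
  fixes x :: real
  assumes "x \<in> {-pi<..pi}"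
  shows "arccos (cos x) = \<bar>x\<bar>"
  using assms arccos_cos2[of x] arccos_cos[of x] by (cases "x \<ge> 0") auto

text \<open>On this interval \<open>sin x\<close> is never of sign opposite to \<open>x\<close>, so
  \<sigma> must be \<open>sgn x\<close>. This turns sign information about sines into the form of
  plus or minus an arccosine.\<close>

lemma eq_sgn_arccos:
  fixes x \<sigma> :: real
  assumes "x \<in> {-pi<..pi}" "\<sigma> \<in> {1, -1}" "\<sigma> * sin x > 0"
  shows "x = \<sigma> * arccos (cos x)"
proof -
  have "sgn x = \<sigma>"
  proof (cases "x \<ge> 0")
    case True
    then have "sin x \<ge> 0" using assms(1) sin_ge_zero by auto
    then show ?thesis using assms(2,3) True by (cases "x = 0") auto
  next
    case False
    then have "sin (- x) \<ge> 0" using assms(1) by (intro sin_ge_zero) auto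
    then show ?thesis using assms(2,3) False by auto
  qed
  then show ?thesis using arccos_cos_abs[OF assms(1)] by (metis mult_sgn_abs)
qed

subsection \<open>Chords of the unit circle\<close>

text \<open>Lagrange's identity for the normal \<open>(x + t, - 2 * y)\<close> of the line and the
  unit vector \<open>(x', y')\<close>: their dot product is fixed by the third assumption, and the
  left-hand side is their squared cross product.\<close>

lemma chord_discriminant:
  fixes t x y x' y' :: real
  assumes "x\<^sup>2 + y\<^sup>2 = 1" "x'\<^sup>2 + y'\<^sup>2 = 1"
    and "t * (x + x') + x * x' - 2 * y * y' = t\<^sup>2 - 2"
  shows "(2 * y * x' + (x + t) * y')\<^sup>2 = (t - x) * ((t\<^sup>2 + 3) * x - t * (t\<^sup>2 - 5))"
proof -
  have "(2 * y * x' + (x + t) * y')\<^sup>2 =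
      ((x + t)\<^sup>2 + 4 * y\<^sup>2) * (x'\<^sup>2 + y'\<^sup>2) - ((x + t) * x' - 2 * y * y')\<^sup>2"
    by algebra
  also have "(x + t) * x' - 2 * y * y' = t\<^sup>2 - 2 - t * x"
    using assms(3) by algebra
  also have "y\<^sup>2 = 1 - x\<^sup>2" using assms(1) by simp
  finally show ?thesis unfolding assms(2) by algebra
qed

text \<open>Resolve the point along the normal \<open>(a, b)\<close> and the tangential direction
  \<open>(b, - a)\<close>. The normal component is given by \<open>d\<close>; the tangential one is
  then determined up to sign by the circle.\<close>

lemma circle_line_point:
  fixes a b d x y :: real
  assumes "x\<^sup>2 + y\<^sup>2 = 1" "a * x + b * y = d" "a\<^sup>2 + b\<^sup>2 \<noteq> 0"
  shows "x = (a * d + (b * x - a * y) * b) / (a\<^sup>2 + b\<^sup>2)"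
    and "y = (b * d - (b * x - a * y) * a) / (a\<^sup>2 + b\<^sup>2)"
    and "(b * x - a * y)\<^sup>2 = a\<^sup>2 + b\<^sup>2 - d\<^sup>2"
proof -
  have "x * (a\<^sup>2 + b\<^sup>2) = a * d + (b * x - a * y) * b"
    and "y * (a\<^sup>2 + b\<^sup>2) = b * d - (b * x - a * y) * a"
    unfolding assms(2)[symmetric] by algebra+
  then show "x = (a * d + (b * x - a * y) * b) / (a\<^sup>2 + b\<^sup>2)"
    "y = (b * d - (b * x - a * y) * a) / (a\<^sup>2 + b\<^sup>2)"
    using assms(3) by (simp_all add: eq_divide_eq)
  show "(b * x - a * y)\<^sup>2 = a\<^sup>2 + b\<^sup>2 - d\<^sup>2"
    using assms(1,2) by algebra
qed

lemma star_conditionI: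
  assumes "x \<in> {-pi<..pi}" "y \<in> {-pi<..pi}" "x \<noteq> y" "a\<^sup>2 + b\<^sup>2 \<noteq> 0"
    and x: "a * cos x + b * sin x = d" and y: "a * cos y + b * sin y = d"
  shows "star_condition a b d x y"
proof -
  define D where "D = sqrt (a\<^sup>2 + b\<^sup>2 - d\<^sup>2)"
  define p where "p \<epsilon> = ((a * d + \<epsilon> * b * D) / (a\<^sup>2 + b\<^sup>2), (b * d - \<epsilon> * a * D) / (a\<^sup>2 + b\<^sup>2))"
    for \<epsilon> :: real
  have *: "\<exists>\<epsilon>\<in>{1, -1}. (cos z, sin z) = p \<epsilon>" if z: "a * cos z + b * sin z = d" for z
  proof -
    note c = circle_line_point[OF sin_cos_squared_add2 z assms(4)]
    \<comment> \<open>The sign of the tangential component is the \<epsilon> of the formula.\<close>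
    have D: "D = \<bar>b * cos z - a * sin z\<bar>" unfolding D_def c(3)[symmetric] by simp
    then have "b * cos z - a * sin z = 1 * D \<or> b * cos z - a * sin z = -1 * D" by auto
    then obtain \<epsilon> where e: "\<epsilon> \<in> {1, -1}" "b * cos z - a * sin z = \<epsilon> * D" by blast
    have "(cos z, sin z) = p \<epsilon>"
      using c(1,2) unfolding p_def e(2) by (simp add: mult_ac)
    then show ?thesis using e(1) by blast
  qed
  obtain e where e: "e \<in> {1, -1}" "(cos x, sin x) = p e" using *[OF x] by blast
  obtain e' where e': "e' \<in> {1, -1}" "(cos y, sin y) = p e'" using *[OF y] by blast
  have "(cos x, sin x) \<noteq> (cos y, sin y)" using cos_sin_eqD[OF assms(1,2)] assms(3) by blast
  \<comment> \<open>Distinct points have distinct signs, so the two points use up both values of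
    \<epsilon>.\<close>
  then have "e \<noteq> e'" unfolding e(2) e'(2) by auto
  then have "{p e, p e'} = {p \<epsilon> | \<epsilon>. \<epsilon> \<in> {1, -1}}" using e(1) e'(1) by auto
  then show ?thesis
    unfolding star_condition_def e(2) e'(2) unfolding p_def D_def .
qed

lemma tangent_unique:
  assumes "x \<in> {-pi<..pi}" "y \<in> {-pi<..pi}" "a\<^sup>2 + b\<^sup>2 \<noteq> 0" "a\<^sup>2 + b\<^sup>2 = d\<^sup>2"
    and x: "a * cos x + b * sin x = d" and y: "a * cos y + b * sin y = d"
  shows "x = y"
proof -
  note cx = circle_line_point[OF sin_cos_squared_add2 x assms(3)]
  note cy = circle_line_point[OF sin_cos_squared_add2 y assms(3)]
  have "b * cos x - a * sin x = 0" "b * cos y - a * sin y = 0"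
    using cx(3) cy(3) assms(4) by simp_all
  note z = this
  have "cos x = cos y" using cx(1) cy(1) unfolding z by simp
  moreover have "sin x = sin y" using cx(2) cy(2) unfolding z by simp
  ultimately show ?thesis by (rule cos_sin_eqD[OF assms(1,2)])
qed

lemma equal_pair_cases:
  fixes t x y x1 y1 :: real
  assumes "x\<^sup>2 + y\<^sup>2 = 1" "x1\<^sup>2 + y1\<^sup>2 = 1"
    and e: "t * (x + x) + x * x - 2 * y * y = t\<^sup>2 - 2"
    and e1: "t * (x1 + x) + x1 * x - 2 * y1 * y = t\<^sup>2 - 2"
    and t: "0 \<le> t" "t \<noteq> 1"
  obtains "x = - t" "x1 = t" "y1 = y"
    | "x = - t" "x1 = - t" "y1 = y"
    | "x = t / 3" "x1 = t / 3" "y1 = y"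
    | "x = t / 3" "x1 = t * (t\<^sup>2 - 5) / (t\<^sup>2 + 3)" "y1 = 3 * (1 - t\<^sup>2) / (t\<^sup>2 + 3) * y"
proof -
  have pos: "t\<^sup>2 + 3 \<noteq> 0" using zero_le_power2[of t] by linarith
  have "(x + t) * (3 * x - t) = 0" using assms(1) e by algebra
  then consider "x = - t" | "x = t / 3" by fastforce
  then show ?thesis
  proof cases
    case 1
    have "t\<^sup>2 \<noteq> 1" using t by (simp add: power2_eq_1_iff)
    then have y0: "y \<noteq> 0" using assms(1) 1 by auto
    \<comment> \<open>For \<open>x = - t\<close> the terms with \<open>x1\<close> cancel in
      \<open>e1\<close>, leaving \<open>y * y1 = y\<^sup>2\<close>. Only the square of
      \<open>x1\<close> is then determined, which yields two outcomes.\<close>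
    have "y * (y1 - y) = 0" using e1 assms(1) unfolding 1 by algebra
    then have "y1 = y" using y0 by simp
    moreover from this have "x1\<^sup>2 = t\<^sup>2" using assms(1,2) 1 by simp
    then have "x1 = t \<or> x1 = - t" by (simp add: power2_eq_iff)
    ultimately show ?thesis using 1 that(1,2) by blast
  next
    case 2
    have t3: "t = 3 * x" using 2 by simp
    \<comment> \<open>Eliminating \<open>y1\<close> gives a quadratic equation for
      \<open>x1\<close>. By \<open>e\<close> one root is \<open>x\<close>; the other is the value
      belonging to the boat.\<close>
    have h: "(x1 - x) * (x1 * (t\<^sup>2 + 3) - t * (t\<^sup>2 - 5)) = 0"
      using e1 assms(1,2) unfolding t3 by algebra
    show ?thesis
    proof (cases "y = 0")
      case True
      \<comment> \<open>Here \<open>t = 3\<close>, the regular hexagon, and \<open>e1\<close>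
        contains no \<open>y1\<close> but fixes \<open>x1\<close>.\<close>
      have "x = 1"
        using assms(1) t(1) 2 True by (simp add: power2_eq_1_iff)
      moreover have "x1 = 1" using e1 True t3 \<open>x = 1\<close> by simp
      ultimately show ?thesis using assms(2) True 2 that(3) by simp
    next
      case False
      from h consider "x1 = x" | "x1 * (t\<^sup>2 + 3) - t * (t\<^sup>2 - 5) = 0" by auto
      then show ?thesis
      proof cases
        case 1
        have "y * (y1 - y) = 0" using e1 e 1 by algebra
        then show ?thesis using False 1 2 that(3) by simp
      next
        case b: 2
        have "y * (y1 * (t\<^sup>2 + 3) - 3 * (1 - t\<^sup>2) * y) = 0"
          using b e1 e assms(1) unfolding t3 by algebra
        then have "y1 * (t\<^sup>2 + 3) = 3 * (1 - t\<^sup>2) * y" using False by simp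
        then show ?thesis using 2 b pos that(4) by (simp add: field_simps)
      qed
    qed
  qed
qed

subsection \<open>The relation between two of the angles\<close>

definition linked :: "real \<Rightarrow> real \<Rightarrow> real \<Rightarrow> bool" where
  "linked t x y \<longleftrightarrow> t * (cos x + cos y) + cos x * cos y - 2 * sin x * sin y = t\<^sup>2 - 2"

text \<open>The discriminant is a square because a partner \<open>y\<close> exists, so
  \<open>cos x\<close> lies between its two roots; \<open>B \<le> t\<close> tells which root is the
  lower one.\<close>

lemma linked_cos_bounds:
  assumes "linked t x y" "0 \<le> t"
  shows "t * (t\<^sup>2 - 5) / (t\<^sup>2 + 3) \<le> cos x" "cos x \<le> t"
proof -
  define B where "B = t * (t\<^sup>2 - 5) / (t\<^sup>2 + 3)"
  have pos: "t\<^sup>2 + 3 > 0" using zero_le_power2[of t] by linarith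
  then have B: "t * (t\<^sup>2 - 5) = (t\<^sup>2 + 3) * B" unfolding B_def by simp
  have "0 \<le> (t - cos x) * ((t\<^sup>2 + 3) * cos x - t * (t\<^sup>2 - 5))"
    using chord_discriminant[of "cos x" "sin x" "cos y" "sin y" t] assms(1)
    by (metis linked_def sin_cos_squared_add2 zero_le_power2)
  also have "\<dots> = (t\<^sup>2 + 3) * ((t - cos x) * (cos x - B))" unfolding B by algebra
  finally have "0 \<le> (t - cos x) * (cos x - B)" using pos by (simp add: zero_le_mult_iff)
  moreover have "B \<le> t"
  proof -
    have "(t\<^sup>2 + 3) * B \<le> (t\<^sup>2 + 3) * t" unfolding B[symmetric]
      using assms(2) by (simp add: algebra_simps)
    then show ?thesis using pos by simp
  qed
  ultimately show "B \<le> cos x" "cos x \<le> t" by (auto simp: zero_le_mult_iff)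
qed

lemma linked_line:
  assumes "linked t x y"
  shows "(cos x + t) * cos y + (- 2 * sin x) * sin y = t\<^sup>2 - 2 - t * cos x"
  using assms unfolding linked_def by algebra

text \<open>The line for the partner angle degenerates only if \<open>t = 1\<close>, that is
  \<theta> = pi/3, the value excluded in the theorem.\<close>

lemma linked_normal_nonzero:
  fixes t x :: real
  assumes "0 \<le> t" "t \<noteq> 1"
  shows "(cos x + t)\<^sup>2 + (- 2 * sin x)\<^sup>2 \<noteq> 0"
proof
  assume "(cos x + t)\<^sup>2 + (- 2 * sin x)\<^sup>2 = 0"
  then have "cos x + t = 0 \<and> - 2 * sin x = 0" by (rule iffD1[OF sum_power2_eq_zero_iff])
  then have *: "cos x = - t" "sin x = 0" by simp_all
  then have "t\<^sup>2 = 1" using sin_cos_squared_add2[of x] by simp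
  then show False using assms by (simp add: power2_eq_1_iff)
qed

text \<open>Both values of \<open>cos x\<close> are roots of the discriminant, so the line touches
  the circle and leaves room for one partner only.\<close>

lemma linked_tangent:
  assumes "y \<in> {-pi<..pi}" "z \<in> {-pi<..pi}" "linked t x y" "linked t x z" "0 \<le> t" "t \<noteq> 1"
    and x: "cos x = t \<or> cos x = t * (t\<^sup>2 - 5) / (t\<^sup>2 + 3)"
  shows "y = z"
proof (rule tangent_unique[OF assms(1,2) linked_normal_nonzero[OF assms(5,6)] _
      linked_line[OF assms(3)] linked_line[OF assms(4)]])
  have "t\<^sup>2 + 3 \<noteq> 0" using zero_le_power2[of t] by linarith
  then have "(t - cos x) * ((t\<^sup>2 + 3) * cos x - t * (t\<^sup>2 - 5)) = 0" using x by auto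
  moreover have "(cos x + t)\<^sup>2 + (- 2 * sin x)\<^sup>2 - (t\<^sup>2 - 2 - t * cos x)\<^sup>2 =
      (t - cos x) * ((t\<^sup>2 + 3) * cos x - t * (t\<^sup>2 - 5))"
    using sin_cos_squared_add2[of x] by algebra
  ultimately show "(cos x + t)\<^sup>2 + (- 2 * sin x)\<^sup>2 = (t\<^sup>2 - 2 - t * cos x)\<^sup>2"
    by linarith
qed

lemma linked_equal_cases:
  assumes "linked t x y" "linked t y y" "0 \<le> t" "t \<noteq> 1"
  obtains "cos y = - t" "cos x = t" "sin x = sin y"
    | "cos y = - t" "cos x = - t" "sin x = sin y"
    | "cos y = t / 3" "cos x = t / 3" "sin x = sin y"
    | "cos y = t / 3" "cos x = t * (t\<^sup>2 - 5) / (t\<^sup>2 + 3)"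
      "sin x = 3 * (1 - t\<^sup>2) / (t\<^sup>2 + 3) * sin y"
  by (rule equal_pair_cases[of "cos y" "sin y" "cos x" "sin x" t])
    (use assms in \<open>auto simp: linked_def\<close>)

text \<open>The assumption is the angle condition at an even vertex, doubled, with
  \<open>2 * cos \<theta> = 4 * C\<^sup>2 - 2\<close>. Dividing by \<open>C\<^sup>2\<close> leaves
  \<open>t\<close> as the only parameter.\<close>

lemma inner_eq_cos_imp_linked:
  assumes "C > 0" "C * t = sqrt 3 * S" "C\<^sup>2 + S\<^sup>2 = 1"
    and "S\<^sup>2 - sqrt 3 * S * C * (cos x + cos y) - C\<^sup>2 * cos x * cos y
        + 2 * C\<^sup>2 * sin x * sin y = 4 * C\<^sup>2 - 2"
  shows "linked t x y"
proof -
  have "(C * t)\<^sup>2 = 3 * S\<^sup>2" unfolding assms(2) by (simp add: power_mult_distrib)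
  then have "C\<^sup>2 * (t * (cos x + cos y) + cos x * cos y - 2 * sin x * sin y) = C\<^sup>2 * (t\<^sup>2 - 2)"
    using assms(2-4) by algebra
  then show ?thesis using assms(1) unfolding linked_def by simp
qed

subsection \<open>The parametrized hexagon\<close>

text \<open>The three formulas have the same shape because of the threefold symmetry of the base
  triangle. An abstract \<open>r\<close> in place of \<open>sqrt 3\<close> keeps the computation
  polynomial, with \<open>rr\<close> as its reduction rule.\<close>

lemma parametrized_inner:
  fixes S C c1 s1 c3 s3 c5 s5 r :: real and P0 P1 P2 P3 P4 P5 :: "real^3"
  assumes r: "r\<^sup>2 = 3"
  defines "P0 \<equiv> vector [- S, 0, 0]" and "P2 \<equiv> vector [S, 0, 0]" and "P4 \<equiv> vector [0, r * S, 0]"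
    and "P1 \<equiv> vector [0, - C * c1, C * s1]"
    and "P3 \<equiv> vector [1/2 * S + r / 2 * C * c3, r / 2 * S + 1/2 * C * c3, C * s3]"
    and "P5 \<equiv> vector [- (1/2) * S - r / 2 * C * c5, r / 2 * S + 1/2 * C * c5, C * s5]"
  shows "2 * ((P1 - P2) \<bullet> (P3 - P2)) =
      S\<^sup>2 - r * S * C * (c1 + c3) - C\<^sup>2 * c1 * c3 + 2 * C\<^sup>2 * s1 * s3"
    and "2 * ((P5 - P0) \<bullet> (P1 - P0)) =
      S\<^sup>2 - r * S * C * (c1 + c5) - C\<^sup>2 * c1 * c5 + 2 * C\<^sup>2 * s1 * s5"
    and "2 * ((P3 - P4) \<bullet> (P5 - P4)) =
      S\<^sup>2 - r * S * C * (c3 + c5) - C\<^sup>2 * c3 * c5 + 2 * C\<^sup>2 * s3 * s5"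
proof -
  have rr: "r * (r * x) = 3 * x" for x
    using r by (simp add: power2_eq_square mult.assoc[symmetric])
  show "2 * ((P1 - P2) \<bullet> (P3 - P2)) =
      S\<^sup>2 - r * S * C * (c1 + c3) - C\<^sup>2 * c1 * c3 + 2 * C\<^sup>2 * s1 * s3"
    "2 * ((P5 - P0) \<bullet> (P1 - P0)) =
      S\<^sup>2 - r * S * C * (c1 + c5) - C\<^sup>2 * c1 * c5 + 2 * C\<^sup>2 * s1 * s5"
    "2 * ((P3 - P4) \<bullet> (P5 - P4)) =
      S\<^sup>2 - r * S * C * (c3 + c5) - C\<^sup>2 * c3 * c5 + 2 * C\<^sup>2 * s3 * s5"
    unfolding P0_def P1_def P2_def P3_def P4_def P5_def
    by (simp_all add: inner_vec_def sum_3 field_simps power2_eq_square rr)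
qed

text \<open>Here \<open>x\<close> is the common value of \<phi>3 and \<phi>5, and \<open>y\<close>
  is \<phi>1. Since \<open>cos x = t / 3\<close>, both \<open>P 3 - P 2\<close> and
  \<open>P 5 - P 0\<close> are orthogonal to \<open>P 2 - P 0\<close>, and they are equal; so the
  parallelogram is at index 1, and \<open>P 1\<close>, \<open>P 4\<close> are the two remaining
  vertices.\<close>

lemma parallelogram_boat_chair:
  fixes P :: hexagon
  assumes hexagon: "equiangular_unit_hexagon \<theta> P"
    and pos: "C > 0" "t > 0" and Ct: "C * t = sqrt 3 * S"
    and x: "cos x = t / 3"
    and P0: "P 0 = vector [- S, 0, 0]"
    and P2: "P 2 = vector [S, 0, 0]"
    and P4: "P 4 = vector [0, sqrt 3 * S, 0]"
    and P1: "P 1 = vector [0, - C * cos y, C * sin y]"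
    and P3: "P 3 = vector [1/2 * S + sqrt 3 / 2 * C * cos x,
                           sqrt 3 / 2 * S + 1/2 * C * cos x, C * sin x]"
    and P5: "P 5 = vector [- (1/2) * S - sqrt 3 / 2 * C * cos x,
                           sqrt 3 / 2 * S + 1/2 * C * cos x, C * sin x]"
  shows "sin x * (sin x * cos y + 2 * t / 3 * sin y) < 0 \<Longrightarrow> boat \<theta> P"
    and "sin x * (sin x * cos y + 2 * t / 3 * sin y) > 0 \<Longrightarrow> chair \<theta> P"
proof -
  have S: "S = C * t / sqrt 3" using Ct by (simp add: field_simps)
  have S0: "S > 0" unfolding S using pos by simp
  have i: "(1::6) - 1 = 0" "(1::6) + 1 = 2" "(1::6) + 2 = 3" "(1::6) - 2 = 5" "(1::6) + 3 = 4"
    using neg_one_6 by simp_all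
  have s: "sqrt 3 * S = C * t" "sqrt 3 * (C * t) = 3 * S"
    unfolding Ct by simp_all
  have xs: "1/2 * S + sqrt 3 / 2 * C * cos x = S"
     "sqrt 3 / 2 * S + 1/2 * C * cos x = 2 / 3 * C * t"
    using s by (simp_all add: x)
  have P3': "P 3 = vector [S, 2 / 3 * C * t, C * sin x]"
    unfolding P3 xs ..
  have "- (1/2) * S - sqrt 3 / 2 * C * cos x = - S" using xs(1) by simp
  then have P5': "P 5 = vector [- S, 2 / 3 * C * t, C * sin x]" unfolding P5 xs by simp
  have nc: "\<not> collinear {P 0, P 2, P 3, P 5}"
  proof
    assume "collinear {P 0, P 2, P 3, P 5}"
    then have "collinear {P 0, P 2, P 3}" by (rule collinear_subset) auto
    then have "collinear {0, P 0 - P 2, P 3 - P 2}" by (subst (asm) collinear_3) auto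
    then show False
      using S0 pos unfolding collinear_lemma P0 P2 P3'
      by (auto simp: vec_eq_iff forall_3)
  qed
  have par: "parallelogram_at P 1"
    unfolding parallelogram_at_def i using nc
    by (auto simp: P0 P2 P3' P5' vec_eq_iff forall_3)
  \<comment> \<open>The plane contains the origin, the first axis and the direction of
    \<open>(0, 2 * t / 3, sin x)\<close>; \<open>n\<close> is orthogonal to both directions.\<close>
  define n :: "real^3" where "n = vector [0, sin x, - (2 * t / 3)]"
  have n0: "n \<noteq> 0" using pos by (auto simp: n_def vec_eq_iff forall_3)
  have plane: "\<forall>z\<in>{P 0, P 2, P 3, P 5}. n \<bullet> z = 0"
    by (simp add: n_def P0 P2 P3' P5' inner_vec_def sum_3)
  have n1: "n \<bullet> P 1 = - C * (sin x * cos y + 2 * t / 3 * sin y)"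
    by (simp add: n_def P1 inner_vec_def sum_3 algebra_simps)
  have n4: "n \<bullet> P 4 = C * t * sin x"
    by (simp add: n_def P4 inner_vec_def sum_3 s)
  have neg: "n \<bullet> P 1 < 0 \<longleftrightarrow> sin x * cos y + 2 * t / 3 * sin y > 0"
     "n \<bullet> P 1 > 0 \<longleftrightarrow> sin x * cos y + 2 * t / 3 * sin y < 0"
     "n \<bullet> P 4 < 0 \<longleftrightarrow> sin x < 0" "n \<bullet> P 4 > 0 \<longleftrightarrow> sin x > 0"
    unfolding n1 n4 using pos by (auto simp: zero_less_mult_iff mult_less_0_iff)
  show "boat \<theta> P" if h: "sin x * (sin x * cos y + 2 * t / 3 * sin y) < 0"
  proof -
    have "(n \<bullet> P 1 > 0 \<and> n \<bullet> P 4 > 0) \<or> (n \<bullet> P 1 < 0 \<and> n \<bullet> P 4 < 0)"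
      using h unfolding neg mult_less_0_iff by blast
    then have "strictly_same_side {P 0, P 2, P 3, P 5} (P 1) (P 4)"
      unfolding strictly_same_side_def using n0 plane by blast
    then show ?thesis unfolding boat_def using hexagon par by (metis i)
  qed
  show "chair \<theta> P" if h: "sin x * (sin x * cos y + 2 * t / 3 * sin y) > 0"
  proof -
    have "(n \<bullet> P 1 > 0 \<and> n \<bullet> P 4 < 0) \<or> (n \<bullet> P 1 < 0 \<and> n \<bullet> P 4 > 0)"
      using h unfolding neg zero_less_mult_iff by blast
    then have "strictly_opposite_sides {P 0, P 2, P 3, P 5} (P 1) (P 4)"
      unfolding strictly_opposite_sides_def using n0 plane by blast
    then show ?thesis unfolding chair_def using hexagon par by (metis i)
  qed
qed

lemma regular_hexagonI:
  fixes P :: hexagon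
  assumes "P 0 = vector [- (sqrt 3 / 2), 0, 0]" "P 1 = vector [0, - (1 / 2), 0]"
    "P 2 = vector [sqrt 3 / 2, 0, 0]" "P 3 = vector [sqrt 3 / 2, 1, 0]"
    "P 4 = vector [0, 3 / 2, 0]" "P 5 = vector [- (sqrt 3 / 2), 1, 0]"
  shows "regular_hexagon P"
proof -
  \<comment> \<open>The centre is \<open>c\<close>, the circumradius is 1, \<open>u\<close> points
    from \<open>c\<close> to \<open>P 0\<close>, and \<open>v\<close> is \<open>u\<close> turned by
    a right angle in the sense of the labelling.\<close>
  define u v c :: "real^3" where "u = vector [- (sqrt 3 / 2), - (1 / 2), 0]"
    and "v = vector [1 / 2, - (sqrt 3 / 2), 0]" and "c = vector [0, 1 / 2, 0]"
  have n: "norm u = 1" "norm v = 1" "u \<bullet> v = 0"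
    by (simp_all add: u_def v_def norm_eq_sqrt_inner inner_vec_def sum_3 power2_eq_square[symmetric] power_divide)
  have trig: "cos (2 * pi / 3) = - (1 / 2)" "sin (2 * pi / 3) = sqrt 3 / 2"
    "cos (4 * pi / 3) = - (1 / 2)" "sin (4 * pi / 3) = - (sqrt 3 / 2)"
    "cos (5 * pi / 3) = 1 / 2" "sin (5 * pi / 3) = - (sqrt 3 / 2)"
    using cos_120 sin_120 cos_periodic_pi[of "pi/3"] sin_periodic_pi[of "pi/3"]
      cos_periodic_pi[of "2*pi/3"] sin_periodic_pi[of "2*pi/3"]
    by (simp_all add: cos_60 sin_60 field_simps)
  have "P (of_nat k) = c + 1 *\<^sub>R (cos (2 * pi * real k / 6) *\<^sub>R u + sin (2 * pi * real k / 6) *\<^sub>R v)"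
    if k: "k < 6" for k
  proof -
    consider "k = 0" | "k = 1" | "k = 2" | "k = 3" | "k = 4" | "k = 5" using k by linarith
    then show ?thesis
      by cases (simp_all add: assms u_def v_def c_def vec_eq_iff forall_3 trig cos_60 sin_60)
  qed
  with n show ?thesis
    unfolding regular_hexagon_def by (intro exI[of _ c] exI[of _ u] exI[of _ v] exI[of _ 1]) auto
qed


section \<open>Extreme and interior positions of the first angle\<close>

lemma boat_cos_bounds:
  fixes t :: real
  assumes "0 < t" "t \<noteq> 1"
  shows "- 1 < t * (t\<^sup>2 - 5) / (t\<^sup>2 + 3)" "t * (t\<^sup>2 - 5) / (t\<^sup>2 + 3) < t"
    and "t < 3 \<Longrightarrow> t * (t\<^sup>2 - 5) / (t\<^sup>2 + 3) < 1"
proof -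
  have pos: "t\<^sup>2 + 3 > 0" using zero_le_power2[of t] by linarith
  \<comment> \<open>This product is the numerator of 1 plus the fraction; the one used for
    \<open>t < 3\<close> is the numerator of 1 minus the fraction.\<close>
  have "0 < (t - 1)\<^sup>2 * (t + 3)" using assms by simp
  also have "\<dots> = t * (t\<^sup>2 - 5) + (t\<^sup>2 + 3)" by algebra
  finally show "- 1 < t * (t\<^sup>2 - 5) / (t\<^sup>2 + 3)" using pos by (simp add: less_divide_eq)
  show "t * (t\<^sup>2 - 5) / (t\<^sup>2 + 3) < t" using pos assms by (simp add: divide_less_eq)
  assume "t < 3"
  then have "0 < (3 - t) * (t + 1)\<^sup>2" using assms by simp
  also have "\<dots> = (t\<^sup>2 + 3) - t * (t\<^sup>2 - 5)" by algebra
  finally show "t * (t\<^sup>2 - 5) / (t\<^sup>2 + 3) < 1" using pos by (simp add: divide_less_eq)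
qed

text \<open>Tangency gives \<open>y = z\<close>. The other three cases of
  \<open>linked_equal_cases\<close> would force \<open>t\<close> to be 0, 1 or 3 or contradict
  \<open>cos x < t\<close>. The last conclusion is the sign test for a boat.\<close>

lemma linked_boat:
  assumes "y \<in> {-pi<..pi}" "z \<in> {-pi<..pi}" "linked t x y" "linked t x z" "linked t y z"
    and t: "0 < t" "t \<noteq> 1" "t < 3" and x: "cos x = t * (t\<^sup>2 - 5) / (t\<^sup>2 + 3)"
  shows "y = z" "cos z = t / 3" "sin x = 3 * (1 - t\<^sup>2) / (t\<^sup>2 + 3) * sin z"
    and "sin z * (sin z * cos x + 2 * t / 3 * sin x) < 0"
proof -
  have pos: "t\<^sup>2 + 3 > 0" using zero_le_power2[of t] by linarith
  have t2: "t\<^sup>2 \<noteq> 1" "t\<^sup>2 \<noteq> 9"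
    using t by (simp_all add: power2_eq_1_iff) (use power2_eq_iff[of t 3] in auto)
  show "y = z" using linked_tangent[OF assms(1-4)] t x by simp
  have x': "cos x * (t\<^sup>2 + 3) = t * (t\<^sup>2 - 5)" using x pos by simp
  have "linked t z z" using assms(5) \<open>y = z\<close> by simp
  have "cos z = t / 3 \<and> sin x = 3 * (1 - t\<^sup>2) / (t\<^sup>2 + 3) * sin z"
  proof (cases rule: linked_equal_cases[OF assms(4) \<open>linked t z z\<close> less_imp_le[OF t(1)] t(2)])
    case 1
    then show ?thesis using boat_cos_bounds(2)[OF t(1,2)] x by simp
  next
    case 2
    then have "t * (t\<^sup>2 - 1) = 0" using x' by algebra
    then show ?thesis using t t2 by simp
  next
    case 3
    then have "t * (t\<^sup>2 - 9) = 0" using x' by algebra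
    then show ?thesis using t t2 by simp
  qed (use t in auto)
  then show z: "cos z = t / 3" and sx: "sin x = 3 * (1 - t\<^sup>2) / (t\<^sup>2 + 3) * sin z" by auto
  have sz: "sin z \<noteq> 0" using sin_zero_abs_cos_one[of z] z t by auto
  \<comment> \<open>With this identity the expression of the sign test becomes
    \<open>- (t * (sin z)\<^sup>2)\<close>.\<close>
  have "cos x + 2 * t / 3 * (3 * (1 - t\<^sup>2) / (t\<^sup>2 + 3)) = - t"
  proof -
    have "2 * t / 3 * (3 * u / v) = 2 * t * u / v" for u v :: real by simp
    then have "cos x + 2 * t / 3 * (3 * (1 - t\<^sup>2) / (t\<^sup>2 + 3)) =
        (t * (t\<^sup>2 - 5) + 2 * t * (1 - t\<^sup>2)) / (t\<^sup>2 + 3)"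
      unfolding x by (simp only: add_divide_distrib)
    also have "t * (t\<^sup>2 - 5) + 2 * t * (1 - t\<^sup>2) = - t * (t\<^sup>2 + 3)" by algebra
    finally show ?thesis using pos by simp
  qed
  then have "sin z * (sin z * cos x + 2 * t / 3 * sin x) = - (t * (sin z)\<^sup>2)"
    unfolding sx by algebra
  then show "sin z * (sin z * cos x + 2 * t / 3 * sin x) < 0" using t sz by simp
qed

lemma linked_inner_extreme:
  assumes "y \<in> {-pi<..pi}" "z \<in> {-pi<..pi}" "linked t x y" "linked t x z" "linked t y z"
    and t: "0 < t" "t \<noteq> 1" and x: "cos x = t"
  shows "y = z" "cos z = - t" "sin x = sin z"
proof -
  show "y = z" using linked_tangent[OF assms(1-4)] t x by simp
  then have "linked t z z" using assms(5) by simp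
  then have "cos z = - t \<and> sin x = sin z"
    by (rule linked_equal_cases[OF assms(4)]) (use t x boat_cos_bounds(2)[OF t] in auto)
  then show "cos z = - t" "sin x = sin z" by auto
qed

text \<open>The strict bounds rule out the first and last cases of
  \<open>linked_equal_cases\<close>; in the two that remain \<open>x\<close> and \<open>y\<close>
  agree in cosine and sine. They are the chair and the inward crown.\<close>

lemma linked_equal_interior_cases:
  assumes r: "x \<in> {-pi<..pi}" "y \<in> {-pi<..pi}" and "linked t x y" "linked t y y"
    and t: "0 < t" "t \<noteq> 1" "t < 3"
    and x: "t * (t\<^sup>2 - 5) / (t\<^sup>2 + 3) < cos x" "cos x < t"
  obtains \<sigma> where "\<sigma> \<in> {1, -1}" "x = y" "cos y = t / 3" "y = \<sigma> * arccos (t / 3)"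
      "sin y * (sin y * cos x + 2 * t / 3 * sin x) > 0"
    | \<sigma> where "\<sigma> \<in> {1, -1}" "x = y" "cos y = - t" "t < 1" "y = \<sigma> * arccos (- t)"
proof -
  have *: "\<exists>\<sigma>\<in>{1, -1}. y = \<sigma> * arccos (cos y)" if "\<bar>cos y\<bar> \<noteq> 1"
  proof -
    have "sin y \<noteq> 0" using that sin_zero_abs_cos_one[of y] by blast
    then have "sgn (sin y) * sin y > 0" by (simp add: sgn_mult_abs abs_sgn[symmetric] mult.commute)
    moreover have "sgn (sin y) \<in> {1, -1}" using \<open>sin y \<noteq> 0\<close> by (auto simp: sgn_if)
    ultimately show ?thesis using eq_sgn_arccos[OF r(2)] by blast
  qed
  consider "cos y = - t" "cos x = - t" "sin x = sin y" | "cos y = t / 3" "cos x = t / 3" "sin x = sin y"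
    by (rule linked_equal_cases[OF assms(3,4)]) (use t x in auto)
  then show ?thesis
  proof cases
    case 1
    have "t < 1" using 1(1) cos_ge_minus_one[of y] t(2) by linarith
    then have "\<bar>cos y\<bar> \<noteq> 1" using 1 t by simp
    then obtain \<sigma> where "\<sigma>\<in>{1, -1}" "y = \<sigma> * arccos (cos y)" using * by blast
    moreover have "x = y" using cos_sin_eqD[OF r] 1 by simp
    ultimately show ?thesis using 1 \<open>t < 1\<close> that(2) by metis
  next
    case 2
    then have "\<bar>cos y\<bar> \<noteq> 1" using t by simp
    then obtain \<sigma> where s: "\<sigma>\<in>{1, -1}" "y = \<sigma> * arccos (cos y)" using * by blast
    have xy: "x = y" using cos_sin_eqD[OF r] 2 by simp
    have "sin y \<noteq> 0"
      using sin_zero_abs_cos_one[of y] 2 t by auto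
    then have "0 < t * (sin y)\<^sup>2" using t by simp
    also have "\<dots> = sin y * (sin y * cos x + 2 * t / 3 * sin x)"
      unfolding 2 by (simp add: power2_eq_square algebra_simps)
    finally show ?thesis using s xy 2 that(1) by metis
  qed
qed

text \<open>With \<open>t = \<surd>3 tan (\<theta>/2)\<close> and \<open>C = cos (\<theta>/2)\<close> one has \<open>C\<^sup>2 (t\<^sup>2 + 3) = 3\<close>.\<close>

lemma tan_less_iff_cos_less:
  fixes C t u r :: real
  assumes "C\<^sup>2 * (t\<^sup>2 + 3) = 3" "u\<^sup>2 * (r\<^sup>2 + 3) = 3" "0 < C" "0 < u" "0 \<le> t" "0 \<le> r"
  shows "t < r \<longleftrightarrow> u < C" "t = r \<longleftrightarrow> C = u"
proof -
  \<comment> \<open>Stated for arbitrary pairs, so that it also applies with the two pairs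
    exchanged.\<close>
  have *: "u < C" if "C\<^sup>2 * (t\<^sup>2 + 3) = 3" "u\<^sup>2 * (r\<^sup>2 + 3) = 3" "0 < C" "0 < u" "0 \<le> t" "t < r"
    for C t u r :: real
  proof -
    have "t\<^sup>2 + 3 < r\<^sup>2 + 3" using that by (simp add: power_strict_mono)
    then have "u\<^sup>2 * (t\<^sup>2 + 3) < u\<^sup>2 * (r\<^sup>2 + 3)"
      using that by (intro mult_strict_left_mono) auto
    then have "u\<^sup>2 * (t\<^sup>2 + 3) < C\<^sup>2 * (t\<^sup>2 + 3)" using that by simp
    then have "u\<^sup>2 < C\<^sup>2" by (rule mult_right_less_imp_less) simp
    then show ?thesis using that by (simp add: power2_less_imp_less)
  qed
  have eq: "u = C" if "t = r"
  proof -
    have "u\<^sup>2 * (t\<^sup>2 + 3) = C\<^sup>2 * (t\<^sup>2 + 3)" using assms that by simp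
    moreover have "t\<^sup>2 + 3 \<noteq> 0" using zero_le_power2[of t] by linarith
    ultimately have "u\<^sup>2 = C\<^sup>2" by simp
    then show ?thesis using assms by (simp add: power2_eq_iff)
  qed
  show "t < r \<longleftrightarrow> u < C" "t = r \<longleftrightarrow> C = u"
    using eq *[OF assms(1-5)] *[OF assms(2,1,4,3,6)] by (metis less_asym linorder_neqE less_irrefl)+
qed

section \<open>The four ranges of the hexagon angle\<close>

theorem theorem3p1:
  fixes \<theta> C S a b d \<phi>1 \<phi>3 \<phi>5 :: real and P :: hexagon
  assumes theta: "0 \<le> \<theta>" "\<theta> < pi" "\<theta> \<noteq> pi / 3"
    and C: "C = cos (\<theta> / 2)" and S: "S = sin (\<theta> / 2)"
    and hexagon: "equiangular_unit_hexagon \<theta> P"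
    and phi: "\<phi>1 \<in> {-pi<..pi}" "\<phi>3 \<in> {-pi<..pi}" "\<phi>5 \<in> {-pi<..pi}"
    and P0: "P 0 = vector [- S, 0, 0]"
    and P2: "P 2 = vector [S, 0, 0]"
    and P4: "P 4 = vector [0, sqrt 3 * S, 0]"
    and P1: "P 1 = vector [0, - C * cos \<phi>1, C * sin \<phi>1]"
    and P3: "P 3 = vector [1/2 * S + sqrt 3 / 2 * C * cos \<phi>3,
                           sqrt 3 / 2 * S + 1/2 * C * cos \<phi>3, C * sin \<phi>3]"
    and P5: "P 5 = vector [- (1/2) * S - sqrt 3 / 2 * C * cos \<phi>5,
                           sqrt 3 / 2 * S + 1/2 * C * cos \<phi>5, C * sin \<phi>5]"
    and a: "a = C * (C * cos \<phi>1 + sqrt 3 * S)"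
    and b: "b = - 2 * C\<^sup>2 * sin \<phi>1"
    and d: "d = 3 - 5 * C\<^sup>2 - sqrt 3 * S * C * cos \<phi>1"
  shows
    \<comment> \<open>1\<close>
    "(\<theta> = 2 * pi / 3 \<longleftrightarrow> C = 1 / 2) \<and>
     (\<theta> = 2 * pi / 3 \<longrightarrow> \<phi>1 = 0 \<and> \<phi>3 = 0 \<and> \<phi>5 = 0 \<and> regular_hexagon P) \<and>
     \<comment> \<open>2\<close>
     (pi / 3 < \<theta> \<and> \<theta> < 2 * pi / 3 \<longleftrightarrow> 1 / 2 < C \<and> C < sqrt 3 / 2) \<and>
     (pi / 3 < \<theta> \<and> \<theta> < 2 * pi / 3 \<longrightarrow>
        - arccos ((3 - 8 * C\<^sup>2) * S / (sqrt 3 * C)) \<le> \<phi>1 \<and>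
        \<phi>1 \<le> arccos ((3 - 8 * C\<^sup>2) * S / (sqrt 3 * C)) \<and>
        \<comment> \<open>(i)\<close>
        (\<forall>\<sigma> \<in> {1, -1}. \<phi>1 = \<sigma> * arccos ((3 - 8 * C\<^sup>2) * S / (sqrt 3 * C)) \<longrightarrow>
           \<phi>3 = \<phi>5 \<and> \<phi>5 = - \<sigma> * arccos (S / (sqrt 3 * C)) \<and> boat \<theta> P) \<and>
        \<comment> \<open>(ii)\<close>
        (- arccos ((3 - 8 * C\<^sup>2) * S / (sqrt 3 * C)) < \<phi>1 \<and>
         \<phi>1 < arccos ((3 - 8 * C\<^sup>2) * S / (sqrt 3 * C)) \<longrightarrow>
           (\<phi>3 \<noteq> \<phi>5 \<and> star_condition a b d \<phi>3 \<phi>5) \<or>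
           (\<exists>\<sigma> \<in> {1, -1}. \<phi>1 = \<phi>3 \<and> \<phi>3 = \<phi>5 \<and>
              \<phi>5 = \<sigma> * arccos (S / (sqrt 3 * C)) \<and> chair \<theta> P))) \<and>
     \<comment> \<open>3\<close>
     (0 < \<theta> \<and> \<theta> < pi / 3 \<longleftrightarrow> sqrt 3 / 2 < C \<and> C < 1) \<and>
     (0 < \<theta> \<and> \<theta> < pi / 3 \<longrightarrow>
        arccos (sqrt 3 * S / C) \<le> \<bar>\<phi>1\<bar> \<and>
        \<bar>\<phi>1\<bar> \<le> arccos ((3 - 8 * C\<^sup>2) * S / (sqrt 3 * C)) \<and>
        \<comment> \<open>(i)\<close>
        (\<forall>\<sigma> \<in> {1, -1}. \<phi>1 = \<sigma> * arccos ((3 - 8 * C\<^sup>2) * S / (sqrt 3 * C)) \<longrightarrow>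
           \<phi>3 = \<phi>5 \<and> \<phi>5 = \<sigma> * arccos (S / (sqrt 3 * C)) \<and> boat \<theta> P) \<and>
        \<comment> \<open>(ii)\<close>
        (\<forall>\<sigma> \<in> {1, -1}. \<phi>1 = \<sigma> * arccos (sqrt 3 * S / C) \<longrightarrow>
           \<phi>3 = \<phi>5 \<and> \<phi>5 = \<sigma> * arccos (- (sqrt 3 * S / C)) \<and>
           \<sigma> * arccos (- (sqrt 3 * S / C)) = \<sigma> * (pi - arccos (sqrt 3 * S / C))) \<and>
        \<comment> \<open>(iii)\<close>
        (arccos (sqrt 3 * S / C) < \<bar>\<phi>1\<bar> \<and>
         \<bar>\<phi>1\<bar> < arccos ((3 - 8 * C\<^sup>2) * S / (sqrt 3 * C)) \<longrightarrow>
           (\<phi>3 \<noteq> \<phi>5 \<and> star_condition a b d \<phi>3 \<phi>5) \<or>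
           (\<exists>\<sigma> \<in> {1, -1}. \<phi>1 = \<phi>3 \<and> \<phi>3 = \<phi>5 \<and>
              \<phi>5 = \<sigma> * arccos (S / (sqrt 3 * C)) \<and> chair \<theta> P) \<or>
           (\<exists>\<sigma> \<in> {1, -1}. \<phi>1 = \<phi>3 \<and> \<phi>3 = \<phi>5 \<and>
              \<phi>5 = \<sigma> * arccos (- (sqrt 3 * S / C)) \<and> inward_crown \<theta> P))) \<and>
     \<comment> \<open>4\<close>
     (\<theta> = 0 \<longrightarrow> P 0 = P 2 \<and> P 2 = P 4 \<and> P 1 = P 3 \<and> P 3 = P 5)"
proof -
  have th2: "0 \<le> \<theta> / 2" "\<theta> / 2 < pi / 2" using theta by auto
  have C0: "C > 0" unfolding C using th2 by (intro cos_gt_zero_pi) auto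
  have S0: "S \<ge> 0" unfolding S using th2 by (intro sin_ge_zero) auto
  have CS: "C\<^sup>2 + S\<^sup>2 = 1" unfolding C S by simp
  define t where "t = sqrt 3 * S / C"
  have Ct: "C * t = sqrt 3 * S" using C0 unfolding t_def by simp
  have t0: "t \<ge> 0" using C0 S0 unfolding t_def by simp
  have s3: "(sqrt 3)\<^sup>2 = (3::real)" by simp
  have C2: "C\<^sup>2 * (t\<^sup>2 + 3) = 3" using Ct CS s3 by algebra
  have pos: "t\<^sup>2 + 3 > 0" using zero_le_power2[of t] by linarith
  have cos_eq: "cos \<theta> = 2 * C\<^sup>2 - 1" using cos_double_cos[of "\<theta> / 2"] unfolding C by simp

  have C_less: "C < cos u \<longleftrightarrow> u < \<theta> / 2" "cos u < C \<longleftrightarrow> \<theta> / 2 < u" "C = cos u \<longleftrightarrow> \<theta> / 2 = u"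
    if "0 \<le> u" "u \<le> pi" for u
    unfolding C using that th2 cos_inj_pi[of "\<theta> / 2" u]
    by (auto simp: cos_mono_less_eq)
  note C_pi3 = C_less[of "pi / 3", unfolded cos_60] and C_pi6 = C_less[of "pi / 6", unfolded cos_30]
  have e1: "\<theta> = 2 * pi / 3 \<longleftrightarrow> C = 1 / 2" using C_pi3 by auto
  have e2: "pi / 3 < \<theta> \<and> \<theta> < 2 * pi / 3 \<longleftrightarrow> 1 / 2 < C \<and> C < sqrt 3 / 2"
    using C_pi3 C_pi6 by auto
  have e3: "0 < \<theta> \<and> \<theta> < pi / 3 \<longleftrightarrow> sqrt 3 / 2 < C \<and> C < 1"
    using C_pi6 C_less[of 0] by auto

  have linkedI: "linked t x y" if "S\<^sup>2 - sqrt 3 * S * C * (cos x + cos y) - C\<^sup>2 * cos x * cos y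
        + 2 * C\<^sup>2 * sin x * sin y = 2 * cos \<theta>" for x y
    by (rule inner_eq_cos_imp_linked[OF C0 Ct CS]) (simp add: that cos_eq)
  have "(P 1 - P 2) \<bullet> (P 3 - P 2) = cos \<theta>" "(P 5 - P 0) \<bullet> (P 1 - P 0) = cos \<theta>"
    "(P 3 - P 4) \<bullet> (P 5 - P 4) = cos \<theta>"
    using hexagon_inner[OF hexagon, of 2] hexagon_inner[OF hexagon, of 0]
      hexagon_inner[OF hexagon, of 4] by (simp_all add: neg_one_6)
  note inner = this[unfolded P0 P1 P2 P3 P4 P5]
  have l13: "linked t \<phi>1 \<phi>3" and l15: "linked t \<phi>1 \<phi>5" and l35: "linked t \<phi>3 \<phi>5"
    by (rule linkedI, subst parametrized_inner[OF s3, symmetric], subst inner, rule refl)+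
  have sym: "linked t y x" if "linked t x y" for x y
    using that unfolding linked_def by (simp add: algebra_simps)

  define B where "B = t * (t\<^sup>2 - 5) / (t\<^sup>2 + 3)"
  have e_t: "sqrt 3 * S / C = t" unfolding t_def ..
  have St: "S = C * t / sqrt 3" unfolding Ct by simp
  have e_t3: "S / (sqrt 3 * C) = t / 3" unfolding St using C0 by simp
  have "C\<^sup>2 = 3 / (t\<^sup>2 + 3)" using C2 pos by (simp add: eq_divide_eq)
  then have e_B: "(3 - 8 * C\<^sup>2) * S / (sqrt 3 * C) = B"
    unfolding times_divide_eq_right[symmetric] e_t3 B_def using pos by (simp add: field_simps)

  have B_le: "B \<le> cos \<phi>1" and le_t: "cos \<phi>1 \<le> t"
    using linked_cos_bounds[OF l13 t0] unfolding B_def by auto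
  note abs_phi = arccos_cos_abs[OF phi(1), symmetric]

  \<comment> \<open>The pairs (\<open>C\<close>, \<open>t\<close>) at \<theta> = pi/3 and \<theta> =
    2 pi/3 are (\<open>sqrt 3 / 2\<close>, 1) and (\<open>1 / 2\<close>, 3).\<close>
  have t_1: "t < 1 \<longleftrightarrow> sqrt 3 / 2 < C" "t = 1 \<longleftrightarrow> C = sqrt 3 / 2"
    and t_3: "t < 3 \<longleftrightarrow> 1 / 2 < C" "t = 3 \<longleftrightarrow> C = 1 / 2"
    using tan_less_iff_cos_less[OF C2 _ C0 _ t0, of "sqrt 3 / 2" 1]
      tan_less_iff_cos_less[OF C2 _ C0 _ t0, of "1 / 2" 3]
    by (simp_all add: power_divide)
  have t1: "t \<noteq> 1" using theta(3) C_pi6 unfolding t_1 by auto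

  \<comment> \<open>The coefficients \<open>a\<close>, \<open>b\<close>, \<open>d\<close> are those
    of \<open>linked_line\<close> multiplied by \<open>C\<^sup>2\<close>.\<close>
  have star: "star_condition a b d \<phi>3 \<phi>5" if "\<phi>3 \<noteq> \<phi>5"
  proof (rule star_conditionI[OF phi(2,3) that])
    have "sqrt 3 * S * C = C\<^sup>2 * t" unfolding Ct[symmetric] by algebra
    then have "d = C\<^sup>2 * (t\<^sup>2 - 2 - t * cos \<phi>1)"
      unfolding d using C2 by (simp add: algebra_simps)
    moreover have "a = C\<^sup>2 * (cos \<phi>1 + t)"
      unfolding a Ct[symmetric] by (simp add: power2_eq_square algebra_simps)
    moreover have "b = C\<^sup>2 * (- 2 * sin \<phi>1)" unfolding b by simp
    ultimately have abd: "a = C\<^sup>2 * (cos \<phi>1 + t)" "b = C\<^sup>2 * (- 2 * sin \<phi>1)"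
      "d = C\<^sup>2 * (t\<^sup>2 - 2 - t * cos \<phi>1)" by blast+
    have "a\<^sup>2 + b\<^sup>2 = C ^ 4 * ((cos \<phi>1 + t)\<^sup>2 + (- 2 * sin \<phi>1)\<^sup>2)"
      unfolding abd by algebra
    then show "a\<^sup>2 + b\<^sup>2 \<noteq> 0" using linked_normal_nonzero[OF t0 t1] C0 by simp
    show "a * cos \<phi>3 + b * sin \<phi>3 = d" "a * cos \<phi>5 + b * sin \<phi>5 = d"
      unfolding abd linked_line[OF l13, symmetric] linked_line[OF l15, symmetric]
      using linked_line[OF l13] linked_line[OF l15] by algebra+
  qed

  have regular: "\<phi>1 = 0 \<and> \<phi>3 = 0 \<and> \<phi>5 = 0 \<and> regular_hexagon P" if "\<theta> = 2 * pi / 3"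
  proof -
    have C': "C = 1 / 2" using that e1 by blast
    then have t: "t = 3" using t_3 by blast
    have S': "S = sqrt 3 / 2" unfolding St C' t by (simp add: real_div_sqrt)
    have zero: "x = 0" if "linked t x y" "x \<in> {-pi<..pi}" for x y
    proof -
      \<comment> \<open>For \<open>t = 3\<close> the lower bound on the cosine equals 1.\<close>
      have "cos x = 1" using linked_cos_bounds(1)[OF that(1) t0] cos_le_one[of x] unfolding t by simp
      then show ?thesis using arccos_cos_abs[OF that(2)] by simp
    qed
    have z: "\<phi>1 = 0" "\<phi>3 = 0" "\<phi>5 = 0"
      using zero[OF l13 phi(1)] zero[OF sym[OF l13] phi(2)] zero[OF sym[OF l15] phi(3)] by auto
    have "regular_hexagon P"
      by (rule regular_hexagonI) (simp_all add: P0 P1 P2 P3 P4 P5 z C' S')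
    then show ?thesis using z by blast
  qed

  have degenerate: "P 0 = P 2 \<and> P 2 = P 4 \<and> P 1 = P 3 \<and> P 3 = P 5" if "\<theta> = 0"
  proof -
    have S': "S = 0" unfolding S that by simp
    then have t: "t = 0" unfolding t_def by simp
    have c0: "cos x = 0" if "linked t x y" for x y
      \<comment> \<open>For \<open>t = 0\<close> both bounds are 0.\<close>
      using linked_cos_bounds[OF that t0] unfolding t by simp
    have c: "cos \<phi>1 = 0" "cos \<phi>3 = 0" "cos \<phi>5 = 0"
      using c0[OF l13] c0[OF sym[OF l13]] c0[OF sym[OF l15]] by auto
    have eq: "sin x = sin y" if "linked t x y" "cos x = 0" "cos y = 0" for x y
    proof -
      have "sin x * sin y = 1" using that unfolding linked_def t by simp
      then have "(sin x - sin y)\<^sup>2 = 0"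
        using sin_cos_squared_add2[of x] sin_cos_squared_add2[of y] that(2,3)
        by (simp add: power2_diff)
      then show ?thesis by simp
    qed
    show ?thesis using eq[OF l13] eq[OF l35] c by (simp add: P0 P1 P2 P3 P4 P5 S')
  qed

  \<comment> \<open>The factor \<open>sgn (1 - t)\<close> serves parts 2 and 3 at once: it is -1 for
    \<theta> > pi/3 and 1 for \<theta> < pi/3, and records whether \<phi>5 has the opposite or the
    same sign as \<phi>1.\<close>
  have boat_phi: "\<phi>3 = \<phi>5 \<and> cos \<phi>5 = t / 3 \<and> \<phi>5 = \<sigma> * sgn (1 - t) * arccos (t / 3) \<and> boat \<theta> P"
    if "0 < t" "t < 3" and s: "\<sigma> \<in> {1, -1}" "\<phi>1 = \<sigma> * arccos B" for \<sigma>
  proof -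
    have Bb: "- 1 < B" "B < 1" using boat_cos_bounds[OF \<open>0 < t\<close> t1] \<open>t < 3\<close> unfolding B_def by auto
    have c: "cos \<phi>1 = B" using s Bb by (auto simp: cos_arccos_abs)
    have sn: "\<sigma> * sin \<phi>1 > 0" using s Bb arccos_lt_bounded[OF Bb] by (auto simp: sin_gt_zero)
    note k = linked_boat[OF phi(2,3) l13 l15 l35 \<open>0 < t\<close> t1 \<open>t < 3\<close> c[unfolded B_def]]
    have "0 < 3 * sgn (1 - t) * (1 - t\<^sup>2) / (t\<^sup>2 + 3)"
    proof -
      have "1 - t\<^sup>2 = (1 - t) * (1 + t)" by algebra
      then have "sgn (1 - t) * (1 - t\<^sup>2) = \<bar>1 - t\<bar> * (1 + t)" by (simp add: abs_sgn mult_ac)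
      also have "\<dots> > 0" using t0 t1 by simp
      finally show ?thesis using pos by simp
    qed
    moreover have sgn1: "sgn (1 - t) * sgn (1 - t) = 1" using t1 by (simp add: sgn_if)
    have "\<sigma> * sin \<phi>1 = 3 * sgn (1 - t) * (1 - t\<^sup>2) / (t\<^sup>2 + 3) * (\<sigma> * sgn (1 - t) * sin \<phi>5)"
      unfolding k(3) using sgn1 by algebra
    ultimately have "\<sigma> * sgn (1 - t) * sin \<phi>5 > 0" using sn by (metis zero_less_mult_pos)
    moreover have "\<sigma> * sgn (1 - t) \<in> {1, -1}" using s(1) t1 by (auto simp: sgn_if)
    ultimately have "\<phi>5 = \<sigma> * sgn (1 - t) * arccos (t / 3)"
      using eq_sgn_arccos[OF phi(3)] k(2) by metis
    moreover have "boat \<theta> P"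
      by (rule parallelogram_boat_chair(1)[OF hexagon C0 \<open>0 < t\<close> Ct k(2) P0 P2 P4 P1
            P3[unfolded k(1)] P5 k(4)])
    ultimately show ?thesis using k by blast
  qed

  \<comment> \<open>Also shared by parts 2 and 3; the conjunct \<open>t < 1\<close> removes the
    crown from part 2.\<close>
  have interior: "(\<phi>3 \<noteq> \<phi>5 \<and> star_condition a b d \<phi>3 \<phi>5) \<or>
      (\<exists>\<sigma> \<in> {1, -1}. \<phi>1 = \<phi>3 \<and> \<phi>3 = \<phi>5 \<and> \<phi>5 = \<sigma> * arccos (t / 3) \<and> chair \<theta> P) \<or>
      (t < 1 \<and> (\<exists>\<sigma> \<in> {1, -1}. \<phi>1 = \<phi>3 \<and> \<phi>3 = \<phi>5 \<and> \<phi>5 = \<sigma> * arccos (- t) \<and> inward_crown \<theta> P))"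
    if "0 < t" "t < 3" "B < cos \<phi>1" "cos \<phi>1 < t"
  proof (cases "\<phi>3 = \<phi>5")
    case False
    then show ?thesis using star by blast
  next
    case eq: True
    show ?thesis
    proof (rule linked_equal_interior_cases[OF phi(1,3) l15 l35[unfolded eq] \<open>0 < t\<close> t1 \<open>t < 3\<close>
          that(3)[unfolded B_def] that(4)])
      fix \<sigma> :: real
      assume "\<sigma> \<in> {1, -1}" and "\<phi>1 = \<phi>5" and c: "cos \<phi>5 = t / 3" and "\<phi>5 = \<sigma> * arccos (t / 3)"
        and k: "sin \<phi>5 * (sin \<phi>5 * cos \<phi>1 + 2 * t / 3 * sin \<phi>1) > 0"
      moreover have "chair \<theta> P"
        by (rule parallelogram_boat_chair(2)[OF hexagon C0 \<open>0 < t\<close> Ct c P0 P2 P4 P1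
            P3[unfolded eq] P5 k])
      ultimately show ?thesis using eq by blast
    next
      fix \<sigma> :: real
      assume s: "\<sigma> \<in> {1, -1}" "\<phi>1 = \<phi>5" "cos \<phi>5 = - t" "t < 1" "\<phi>5 = \<sigma> * arccos (- t)"
      have "sqrt 3 / 2 < C" using s t_1 by blast
      moreover have "C < 1"
        using tan_less_iff_cos_less[OF _ C2 _ C0 _ t0, of 1 0] \<open>0 < t\<close> by simp
      ultimately have th: "0 < \<theta>" "\<theta> < pi / 3" using e3 by blast+
      have "(C * sin \<phi>5)\<^sup>2 = 4 * C\<^sup>2 - 3"
        using sin_cos_squared_add[of \<phi>5] C2 unfolding s(3) by algebra
      then have "\<bar>C * sin \<phi>5\<bar> = sqrt (4 * C\<^sup>2 - 3)" by (metis real_sqrt_abs)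
      then have h: "C * sin \<phi>5 \<in> {sqrt (4 * C\<^sup>2 - 3), - sqrt (4 * C\<^sup>2 - 3)}" by auto
      \<comment> \<open>With cosine \<open>- t\<close>, the points \<open>P 1\<close>,
        \<open>P 3\<close>, \<open>P 5\<close> project onto \<open>P 4\<close>, \<open>P 0\<close>,
        \<open>P 2\<close>, all at the same signed height.\<close>
      have v: "1/2 * S + sqrt 3 / 2 * C * cos \<phi>5 = - S" "sqrt 3 / 2 * S + 1/2 * C * cos \<phi>5 = 0"
        "- (1/2) * S - sqrt 3 / 2 * C * cos \<phi>5 = S"  "- C * cos \<phi>5 = sqrt 3 * S"
        unfolding s(3) using Ct s3 by algebra+
      have "inward_crown \<theta> P"
        unfolding inward_crown_def Let_def C[symmetric] S[symmetric]
        using th by (intro conjI bexI[OF _ h])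
          (simp_all only: P0 P1 P2 P3 P4 P5 eq s(2) v)
      then show ?thesis using s eq by blast
    qed
  qed

  have part2: "- arccos B \<le> \<phi>1 \<and> \<phi>1 \<le> arccos B \<and>
      (\<forall>\<sigma> \<in> {1, -1}. \<phi>1 = \<sigma> * arccos B \<longrightarrow> \<phi>3 = \<phi>5 \<and> \<phi>5 = - \<sigma> * arccos (t / 3) \<and> boat \<theta> P) \<and>
      (- arccos B < \<phi>1 \<and> \<phi>1 < arccos B \<longrightarrow>
        (\<phi>3 \<noteq> \<phi>5 \<and> star_condition a b d \<phi>3 \<phi>5) \<or>
        (\<exists>\<sigma> \<in> {1, -1}. \<phi>1 = \<phi>3 \<and> \<phi>3 = \<phi>5 \<and> \<phi>5 = \<sigma> * arccos (t / 3) \<and> chair \<theta> P))"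
    if "pi / 3 < \<theta> \<and> \<theta> < 2 * pi / 3"
  proof -
    have t: "1 < t" "t < 3" using that t_1 t_3 unfolding e2 by auto
    have Bb: "- 1 < B" "B < 1" using boat_cos_bounds[of t] t unfolding B_def by auto
    have le: "\<bar>\<phi>1\<bar> \<le> arccos B"
      unfolding abs_phi using B_le Bb by (intro arccos_le_arccos) auto
    have "B < cos \<phi>1" if "\<bar>\<phi>1\<bar> < arccos B"
      using that B_le unfolding abs_phi by (cases "B = cos \<phi>1") auto
    \<comment> \<open>Since \<open>t > 1\<close>, the upper root imposes no bound in this
      range.\<close>
    moreover have "cos \<phi>1 < t" using t cos_le_one[of \<phi>1] by linarith
    ultimately show ?thesis
      using le boat_phi interior t by (auto simp: abs_le_iff abs_less_iff)
  qed

  have part3: "arccos t \<le> \<bar>\<phi>1\<bar> \<and> \<bar>\<phi>1\<bar> \<le> arccos B \<and>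
      (\<forall>\<sigma> \<in> {1, -1}. \<phi>1 = \<sigma> * arccos B \<longrightarrow> \<phi>3 = \<phi>5 \<and> \<phi>5 = \<sigma> * arccos (t / 3) \<and> boat \<theta> P) \<and>
      (\<forall>\<sigma> \<in> {1, -1}. \<phi>1 = \<sigma> * arccos t \<longrightarrow> \<phi>3 = \<phi>5 \<and> \<phi>5 = \<sigma> * arccos (- t) \<and>
        \<sigma> * arccos (- t) = \<sigma> * (pi - arccos t)) \<and>
      (arccos t < \<bar>\<phi>1\<bar> \<and> \<bar>\<phi>1\<bar> < arccos B \<longrightarrow>
        (\<phi>3 \<noteq> \<phi>5 \<and> star_condition a b d \<phi>3 \<phi>5) \<or>
        (\<exists>\<sigma> \<in> {1, -1}. \<phi>1 = \<phi>3 \<and> \<phi>3 = \<phi>5 \<and> \<phi>5 = \<sigma> * arccos (t / 3) \<and> chair \<theta> P) \<or>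
        (\<exists>\<sigma> \<in> {1, -1}. \<phi>1 = \<phi>3 \<and> \<phi>3 = \<phi>5 \<and> \<phi>5 = \<sigma> * arccos (- t) \<and> inward_crown \<theta> P))"
    if "0 < \<theta> \<and> \<theta> < pi / 3"
  proof -
    have "0 < S" unfolding S using that by (intro sin_gt_zero) auto
    then have t: "0 < t" "t < 1" using that C0 t_1 unfolding e3 t_def by auto
    have Bb: "- 1 < B" "B < 1" using boat_cos_bounds[of t] t unfolding B_def by auto
    have le: "\<bar>\<phi>1\<bar> \<le> arccos B" "arccos t \<le> \<bar>\<phi>1\<bar>"
      unfolding abs_phi using B_le le_t Bb t by (auto intro!: arccos_le_arccos)
    have "B < cos \<phi>1" if "\<bar>\<phi>1\<bar> < arccos B"
      using that B_le unfolding abs_phi by (cases "B = cos \<phi>1") auto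
    moreover have "cos \<phi>1 < t" if "arccos t < \<bar>\<phi>1\<bar>"
      using that le_t unfolding abs_phi by (cases "cos \<phi>1 = t") auto
    moreover have "\<phi>3 = \<phi>5 \<and> \<phi>5 = \<sigma> * arccos (- t)" if s: "\<sigma> \<in> {1, -1}" "\<phi>1 = \<sigma> * arccos t" for \<sigma>
    proof -
      have c: "cos \<phi>1 = t" using s t by (auto simp: cos_arccos_abs)
      have sn: "\<sigma> * sin \<phi>1 > 0" using s t arccos_lt_bounded[of t] by (auto simp: sin_gt_zero)
      note k = linked_inner_extreme[OF phi(2,3) l13 l15 l35 t(1) t1 c]
      \<comment> \<open>The sines of \<phi>1 and \<phi>5 agree, so \<phi>5 inherits the sign
        \<sigma>.\<close>
      show ?thesis using eq_sgn_arccos[OF phi(3) s(1)] sn k by simp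
    qed
    moreover have "arccos (- t) = pi - arccos t" using t by (intro arccos_minus) auto
    moreover have "sgn (1 - t) = 1" "t < 3" using t by simp_all
    ultimately show ?thesis using le boat_phi interior t by simp
  qed

  show ?thesis
    unfolding e_B e_t e_t3
    using e1 e2 e3 regular degenerate part2 part3 by blast
qed

end
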